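(* Let $k\ge 2$ be an integer and let $\mathbf{a}=(a_n)_{n\in\mathbb{Z}}\in\Sigma_k=\{1,\ldots,k\}^{\mathbb{Z}}$. For any $\epsilon>0$, there exists a Toeplitz sequence $\mathbf{b}=(b_n)_{n\in\mathbb{Z}}\in\Sigma_k$ such that (1) $h(X_{\mathbf{b}},\sigma)\le 2h(X_{\mathbf{a}},\sigma)$; (2) $\displaystyle\lim_{N\to\infty}\frac{1}{2N+1}\sum_{n=-N}^{N}|a_n-b_n|<\epsilon$.
   Context: Let $\Sigma_k=\{1,\ldots,k\}^{\mathbb{Z}}$ carry the product topology (of the discrete topology on $\{1,\ldots,k\}$), and let $\sigma:\Sigma_k\to\Sigma_k$ be the shift, $(\sigma\mathbf{x})_n=x_{n+1}$ for all $n\in\mathbb{Z}$. For $\omega\in\Sigma_k$, $X_\omega$ denotes the closure of the orbit $\{\sigma^n\omega:n\in\mathbb{Z}\}$; $(X_\omega,\sigma)$ is a subshift. For a subshift $(X,\sigma)$, let $B_n(X)$ be the set of all words of length $n$ occurring in elements of $X$. The topological entropy is $h(X,\sigma)=\lim_{n\to\infty}\frac{\log\# B_n(X)}{n}$, where $\#$ denotes cardinality. A sequence $\omega\in\Sigma_k$ is a Toeplitz sequence if it is a regularly recurrent point of $(\Sigma_k,\sigma)$: for every open neighborhood $U$ of $\omega$ there is a positive integer $l$ such that $\sigma^{m}\omega\in U$ for all $m\in l\mathbb{Z}$. *)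

theory Defs
  imports "HOL-Analysis.Analysis"
begin

definition full_shift :: "nat \<Rightarrow> (int \<Rightarrow> nat) topology" where
  "full_shift k = product_topology (\<lambda>_. discrete_topology {1..k}) UNIV"

lemma topspace_full_shift: "topspace (full_shift k) = {x. \<forall>n. x n \<in> {1..k}}"
  by (auto simp: full_shift_def PiE_iff)

definition shift :: "(int \<Rightarrow> nat) \<Rightarrow> int \<Rightarrow> nat" where
  "shift x = (\<lambda>n. x (n + 1))"

(* Integer powers of the invertible map shift, given in closed form; the three lemmas
   below show that this is the group of iterates generated by shift. *)
definition shift_pow :: "int \<Rightarrow> (int \<Rightarrow> nat) \<Rightarrow> int \<Rightarrow> nat" where
  "shift_pow m x = (\<lambda>n. x (n + m))"

lemma shift_pow_of_nat: "shift_pow (int m) = shift ^^ m"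
  by (induction m) (auto simp: shift_pow_def shift_def fun_eq_iff algebra_simps)

lemma bij_shift: "bij shift"
  by (rule o_bij[of "shift_pow (-1)"]) (auto simp: shift_pow_def shift_def fun_eq_iff)

lemma shift_pow_minus_of_nat: "shift_pow (- int m) = inv shift ^^ m"
proof -
  have inv: "inv shift = shift_pow (-1)"
    by (rule inv_unique_comp) (auto simp: shift_pow_def shift_def fun_eq_iff)
  show ?thesis
    unfolding inv by (induction m) (simp_all add: shift_pow_def fun_eq_iff algebra_simps)
qed

definition orbit_closure :: "nat \<Rightarrow> (int \<Rightarrow> nat) \<Rightarrow> (int \<Rightarrow> nat) set" where
  "orbit_closure k x = full_shift k closure_of range (\<lambda>n. shift_pow n x)"

definition words :: "nat \<Rightarrow> (int \<Rightarrow> nat) set \<Rightarrow> nat list set" where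
  "words n X = {map (\<lambda>i. x (m + int i)) [0..<n] | x m. x \<in> X}"

(* For a nonempty subshift X the limit exists by subadditivity of n \<mapsto> ln (card (words n X)). *)
definition entropy :: "(int \<Rightarrow> nat) set \<Rightarrow> real" where
  "entropy X = lim (\<lambda>n. ln (real (card (words n X))) / real n)"

definition regularly_recurrent :: "nat \<Rightarrow> (int \<Rightarrow> nat) \<Rightarrow> bool" where
  "regularly_recurrent k x \<longleftrightarrow>
     (\<forall>U. openin (full_shift k) U \<and> x \<in> U \<longrightarrow>
        (\<exists>l::int. l > 0 \<and> (\<forall>m. l dvd m \<longrightarrow> shift_pow m x \<in> U)))"

definition toeplitz :: "nat \<Rightarrow> (int \<Rightarrow> nat) \<Rightarrow> bool" where
  "toeplitz k x \<longleftrightarrow> x \<in> topspace (full_shift k) \<and> regularly_recurrent k x"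

end

theory Submission
  imports Defs
begin

text \<open>
  The sequence \<open>b\<close> copies \<open>a\<close> cell by cell. At level \<open>j\<close> the integers are cut into cells of
  odd length \<open>len j\<close>, one of them centred at \<open>0\<close>; a cell of level \<open>j + 1\<close> consists of
  \<open>2 * radius j + 1\<close> cells of level \<open>j\<close>. In every cell of level \<open>j + 1\<close> the middle subcell of
  level \<open>j\<close> receives one fixed content, namely the content of the cell of level \<open>j\<close> around
  \<open>0\<close>. Hence \<open>b\<close> repeats its values on that cell with period \<open>len (j + 1)\<close>, and as these cells
  exhaust the integers, \<open>b\<close> is a Toeplitz sequence.

  Forcing the middle subcells costs errors, in a number that depends on \<open>a\<close>, and the averages of
  these forced errors need not converge. They are therefore completed by deliberate errors: a copy
  of a cell is made with an error that is prescribed exactly, the prescribed value being any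
  integer of an interval \<open>{lo j..lo j + gap j}\<close>. On level \<open>0\<close> this means keeping the symbol
  (error 0) or moving it to a neighbouring symbol (error 1). On level \<open>j + 1\<close> the middle subcell
  makes whatever error it makes, and the rest of the prescribed error is distributed as a budget
  over the other subcells (\<open>err_fill\<close>). The interval can be chosen with \<open>lo j / len j\<close> increasing
  to a limit, the density, of size at most \<open>k / K\<close>, and with \<open>gap j / len j\<close> tending to
  \<open>0\<close>. Up to a vanishing proportion, every window is then composed of cells whose error per
  symbol is close to the density (\<open>sum_deviation\<close>), so the averages converge to it; a large \<open>K\<close>
  makes it small.

  For the entropy, \<open>b\<close> is a concatenation of cell contents of level \<open>j\<close>, and such a content is
  determined by a word of \<open>a\<close> of the same length and by the prescribed error, for which there are
  only \<open>gap j + 1\<close> values, at most linearly many in \<open>len j\<close> (\<open>card_cells\<close>). In the limit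
  this gives \<open>h(X\<^sub>b) \<le> h(X\<^sub>a)\<close>, which implies the stated bound because entropy is nonnegative.
\<close>

section \<open>Entropy\<close>

text \<open>
  Fekete's lemma: the quotients converge to their infimum \<open>L\<close>, because division with remainder by
  an \<open>m\<close> whose quotient almost attains \<open>L\<close> bounds \<open>u n\<close> by \<open>n div m\<close> times \<open>u m\<close> plus a
  constant.
\<close>
lemma fekete:
  fixes u :: "nat \<Rightarrow> real"
  assumes nonneg: "\<And>n. 0 \<le> u n" and sub: "\<And>m n. u (m + n) \<le> u m + u n"
  shows "convergent (\<lambda>n. u n / real n)"
proof -
  define L where "L = (INF n\<in>{1..}. u n / real n)"
  have bdd: "bdd_below ((\<lambda>n. u n / real n) ` {1..})"
    by (rule bdd_belowI[of _ 0]) (auto simp: nonneg)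
  have low: "L \<le> u n / real n" if "n \<ge> 1" for n
    unfolding L_def by (rule cINF_lower[OF bdd]) (use that in simp)
  have mult: "u (q * m + r) \<le> real q * u m + u r" for q m r
  proof (induction q)
    case (Suc q)
    then show ?case using sub[of m "q * m + r"] by (simp add: algebra_simps)
  qed simp
  have "(\<lambda>n. u n / real n) \<longlonglongrightarrow> L"
  proof (rule LIMSEQ_I)
    fix e :: real assume e: "e > 0"
    have "\<exists>m\<in>{1..}. u m / real m < L + e / 2"
      using cINF_less_iff[of "{1..}" "\<lambda>n. u n / real n" "L + e / 2"] bdd e
      unfolding L_def by auto
    then obtain m where m: "m \<ge> 1" "u m / real m < L + e / 2" by auto
    define C where "C = Max (u ` {..<m})"
    have C: "u r \<le> C" if "r < m" for r
      unfolding C_def using that by (intro Max_ge) auto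
    have "C \<ge> 0" using C[of 0] nonneg[of 0] m(1) by linarith
    obtain n0 :: nat where n0: "real n0 > 2 * C / e" using reals_Archimedean2 by blast
    have "norm (u n / real n - L) < e" if n: "n \<ge> Suc n0" for n
    proof -
      have npos: "real n > 0" using n by simp
      have "u n \<le> real (n div m) * u m + u (n mod m)"
        using mult[of "n div m" m "n mod m"] by simp
      also have "\<dots> \<le> real (n div m) * u m + C"
        using C[of "n mod m"] m(1) by simp
      also have "real (n div m) * u m = real (n div m * m) * (u m / real m)"
        using m(1) by simp
      also have "\<dots> \<le> real n * (u m / real m)"
        using nonneg[of m] by (intro mult_right_mono) (simp_all only: of_nat_le_iff div_times_less_eq_dividend, simp)
      finally have "u n / real n \<le> u m / real m + C / real n"
        using npos by (simp add: field_simps)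
      moreover have "C / real n < e / 2"
      proof -
        have "2 * C / e < real n" using n0 n by linarith
        then show ?thesis using npos e by (simp add: field_simps)
      qed
      ultimately show ?thesis unfolding real_norm_def using m(2) low[of n] n by linarith
    qed
    then show "\<exists>no. \<forall>n\<ge>no. norm (u n / real n - L) < e" by blast
  qed
  then show ?thesis by (auto simp: convergent_def)
qed

lemma openin_cylinder:
  assumes "finite F" "\<And>i. i \<in> F \<Longrightarrow> y i \<in> {1..k}"
  shows "openin (full_shift k) {z \<in> topspace (full_shift k). \<forall>i\<in>F. z i = y i}"
proof -
  define X where "X i = (if i \<in> F then {y i} else {1..k})" for i
  have "openin (full_shift k) (PiE UNIV X)"
    unfolding full_shift_def using assms
    by (intro product_topology_basis) (auto simp: X_def intro: finite_subset[of _ F])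
  moreover have "PiE UNIV X = {z \<in> topspace (full_shift k). \<forall>i\<in>F. z i = y i}"
  proof (rule set_eqI)
    fix z
    have "z i \<in> X i \<longleftrightarrow> z i \<in> {1..k} \<and> (i \<in> F \<longrightarrow> z i = y i)" for i
      using assms(2)[of i] by (auto simp: X_def)
    then show "z \<in> PiE UNIV X \<longleftrightarrow> z \<in> {z \<in> topspace (full_shift k). \<forall>i\<in>F. z i = y i}"
      by (auto simp: topspace_full_shift PiE_iff)
  qed
  ultimately show ?thesis by simp
qed

definition factor :: "(int \<Rightarrow> nat) \<Rightarrow> int \<Rightarrow> nat \<Rightarrow> nat list" where
  "factor x m n = map (\<lambda>i. x (m + int i)) [0..<n]"

lemma length_factor [simp]: "length (factor x m n) = n"
  by (simp add: factor_def)

lemma factor_add: "factor x m (p + q) = factor x m p @ factor x (m + int p) q"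
  by (rule nth_equalityI) (auto simp: factor_def nth_append)

lemma words_eq_factors: "words n X = {factor x m n | x m. x \<in> X}"
  unfolding words_def factor_def ..

text \<open>
  Passing to the closure creates no new words, since a window of a point of the closure is
  prescribed by a cylinder, which is an open set and so meets the orbit.
\<close>
lemma words_orbit_closure:
  assumes x: "x \<in> topspace (full_shift k)"
  shows "words n (orbit_closure k x) = range (\<lambda>m. factor x m n)"
proof (intro equalityI subsetI)
  fix v assume "v \<in> words n (orbit_closure k x)"
  then obtain y m where v: "v = factor y m n" and y: "y \<in> orbit_closure k x"
    unfolding words_eq_factors by blast
  define F where "F = (\<lambda>i. m + int i) ` {..<n}"
  let ?C = "{z \<in> topspace (full_shift k). \<forall>i\<in>F. z i = y i}"
  have yt: "y \<in> topspace (full_shift k)"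
    using y unfolding orbit_closure_def in_closure_of by simp
  have openC: "openin (full_shift k) ?C"
  proof (rule openin_cylinder)
    show "finite F" by (simp add: F_def)
    show "y i \<in> {1..k}" for i using yt unfolding topspace_full_shift by simp
  qed
  have meets: "\<exists>p. shift_pow p x \<in> T" if "y \<in> T" "openin (full_shift k) T" for T
    using y that unfolding orbit_closure_def in_closure_of by simp
  have "y \<in> ?C" using yt by simp
  from meets[OF this openC] obtain p where "shift_pow p x \<in> ?C" ..
  then have p: "\<forall>i\<in>F. shift_pow p x i = y i" by simp
  have "v = factor x (m + p) n"
    unfolding v factor_def
  proof (rule map_cong[OF refl])
    fix i assume "i \<in> set [0..<n]"
    then have "m + int i \<in> F" by (simp add: F_def)
    then have "y (m + int i) = shift_pow p x (m + int i)" using p by simp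
    then show "y (m + int i) = x (m + p + int i)"
      by (simp add: shift_pow_def ac_simps)
  qed
  then show "v \<in> range (\<lambda>m. factor x m n)" by blast
next
  fix v assume "v \<in> range (\<lambda>m. factor x m n)"
  then obtain m where v: "v = factor x m n" by blast
  have "shift_pow 0 x = x" by (simp add: shift_pow_def)
  then have "x \<in> range (\<lambda>n. shift_pow n x)" by (metis rangeI)
  moreover have "range (\<lambda>n. shift_pow n x) \<subseteq> topspace (full_shift k)"
    using x by (auto simp: topspace_full_shift shift_pow_def)
  ultimately have "x \<in> orbit_closure k x"
    unfolding orbit_closure_def using closure_of_subset by blast
  with v show "v \<in> words n (orbit_closure k x)"
    unfolding words_eq_factors by blast
qed

lemma finite_factors:
  assumes x: "x \<in> topspace (full_shift k)"
  shows "finite (range (\<lambda>m. factor x m n))"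
proof (rule finite_subset)
  show "range (\<lambda>m. factor x m n) \<subseteq> {v. set v \<subseteq> {1..k} \<and> length v = n}"
    using x by (auto simp: factor_def topspace_full_shift)
  show "finite {v. set v \<subseteq> {1..k} \<and> length v = n}"
    by (rule finite_lists_length_eq) simp
qed

lemma card_factors_pos:
  assumes x: "x \<in> topspace (full_shift k)"
  shows "card (range (\<lambda>m. factor x m n)) > 0"
  using finite_factors[OF x] by (simp add: card_gt_0_iff)

text \<open>
  The entropy is defined through \<open>lim\<close>, so estimating it requires the limit to exist; word counts
  are submultiplicative because a word splits into a prefix and a suffix.
\<close>
lemma entropy_limit:
  assumes x: "x \<in> topspace (full_shift k)"
  shows "(\<lambda>n. ln (real (card (range (\<lambda>m. factor x m n)))) / real n)
           \<longlonglongrightarrow> entropy (orbit_closure k x)"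
proof -
  define B where "B n = range (\<lambda>m. factor x m n)" for n
  have pos: "card (B n) > 0" for n unfolding B_def by (rule card_factors_pos[OF x])
  have "card (B (m + n)) \<le> card (B m) * card (B n)" for m n
  proof -
    have fin: "finite (B n)" for n unfolding B_def by (rule finite_factors[OF x])
    have "B (m + n) \<subseteq> (\<lambda>(u, v). u @ v) ` (B m \<times> B n)"
      by (auto simp: B_def factor_add)
    then have "card (B (m + n)) \<le> card ((\<lambda>(u, v). u @ v) ` (B m \<times> B n))"
      by (intro card_mono finite_imageI finite_cartesian_product fin)
    also have "\<dots> \<le> card (B m \<times> B n)" by (intro card_image_le finite_cartesian_product fin)
    finally show ?thesis by (simp add: card_cartesian_product)
  qed
  then have prod_le: "real (card (B (m + n))) \<le> real (card (B m)) * real (card (B n))" for m n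
    by (metis of_nat_le_iff of_nat_mult)
  have sub: "ln (real (card (B (m + n)))) \<le> ln (real (card (B m))) + ln (real (card (B n)))" for m n
  proof -
    have "ln (real (card (B (m + n)))) \<le> ln (real (card (B m)) * real (card (B n)))"
      using prod_le[of m n] pos[of m] pos[of n] pos[of "m + n"] by (subst ln_le_cancel_iff) auto
    then show ?thesis using pos[of m] pos[of n] by (simp add: ln_mult_pos)
  qed
  have "1 \<le> real (card (B n))" for n using pos[of n] by simp
  then have nonneg: "0 \<le> ln (real (card (B n)))" for n by (rule ln_ge_zero)
  have "convergent (\<lambda>n. ln (real (card (B n))) / real n)"
    by (rule fekete[OF nonneg sub])
  then show ?thesis
    unfolding entropy_def words_orbit_closure[OF x] B_def convergent_LIMSEQ_iff .
qed

lemma entropy_nonneg: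
  assumes "x \<in> topspace (full_shift k)"
  shows "0 \<le> entropy (orbit_closure k x)"
proof (rule LIMSEQ_le_const[OF entropy_limit[OF assms]], intro exI allI impI divide_nonneg_nonneg)
  fix n
  have "1 \<le> real (card (range (\<lambda>m. factor x m n)))" using card_factors_pos[OF assms, of n] by simp
  then show "0 \<le> ln (real (card (range (\<lambda>m. factor x m n))))" by (rule ln_ge_zero)
qed simp

text \<open>
  Only the words at positions of one residue class modulo their length \<open>L\<close> count: a word of length
  \<open>c * L\<close> lies inside \<open>c + 1\<close> consecutive aligned ones, and its offset there is one of \<open>L\<close>
  numbers. The factor \<open>L\<close> and the additional aligned word disappear as \<open>c\<close> grows.
\<close>
lemma entropy_le_aligned:
  assumes x: "x \<in> topspace (full_shift k)" and "L > 0"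
  shows "entropy (orbit_closure k x)
           \<le> ln (real (card (range (\<lambda>t. factor x (t * int L + z) L)))) / real L"
proof -
  define V where "V = range (\<lambda>t. factor x (t * int L + z) L)"
  have finV: "finite V"
    unfolding V_def using finite_factors[OF x, of L] by (rule finite_subset[rotated]) auto
  have Vpos: "card V > 0" using finV by (simp add: V_def card_gt_0_iff)
  have conc: "factor x (t * int L + z) (c * L)
      = concat (map (\<lambda>i. factor x ((t + int i) * int L + z) L) [0..<c])" for t c
  proof (induction c)
    case (Suc c)
    have "Suc c * L = c * L + L" by simp
    then have "factor x (t * int L + z) (Suc c * L)
        = factor x (t * int L + z) (c * L) @ factor x (t * int L + z + int (c * L)) L"
      by (simp only: factor_add)
    also have "t * int L + z + int (c * L) = (t + int c) * int L + z"
      by (simp add: algebra_simps)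
    finally show ?case using Suc by simp
  qed (simp add: factor_def)
  have bound: "card (range (\<lambda>m. factor x m (c * L))) \<le> L * card V ^ Suc c" for c
  proof -
    let ?g = "\<lambda>(p, vs). take (c * L) (drop p (concat vs))"
    let ?S = "{..<L} \<times> {vs. set vs \<subseteq> V \<and> length vs = Suc c}"
    have "range (\<lambda>m. factor x m (c * L)) \<subseteq> ?g ` ?S"
    proof (rule image_subsetI)
      fix m :: int
      define t where "t = (m - z) div int L"
      define p where "p = nat ((m - z) mod int L)"
      have m: "m = t * int L + z + int p" and p: "p < L"
        using \<open>L > 0\<close> by (auto simp: t_def p_def nat_less_iff)
      define vs where "vs = map (\<lambda>i. factor x ((t + int i) * int L + z) L) [0..<Suc c]"
      have "concat vs = factor x (t * int L + z) (Suc c * L)"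
        unfolding vs_def conc ..
      also have "Suc c * L = p + (c * L + (L - p))" using p by simp
      finally have "concat vs = factor x (t * int L + z) p @ factor x m (c * L)
                      @ factor x (m + int (c * L)) (L - p)"
        by (simp only: factor_add m)
      then have "factor x m (c * L) = ?g (p, vs)" by simp
      moreover have "(p, vs) \<in> ?S" using p by (auto simp: vs_def V_def)
      ultimately show "factor x m (c * L) \<in> ?g ` ?S" by (rule image_eqI)
    qed
    moreover have finS: "finite ?S" by (intro finite_cartesian_product finite_lists_length_eq finV) simp
    ultimately have "card (range (\<lambda>m. factor x m (c * L))) \<le> card ?S"
      by (meson card_image_le card_mono finite_imageI order_trans)
    also have "card ?S = L * card V ^ Suc c"
      by (simp add: card_cartesian_product card_lists_length_eq[OF finV])
    finally show ?thesis .
  qed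
  have sub: "(\<lambda>c. ln (real (card (range (\<lambda>m. factor x m (c * L))))) / real (c * L))
          \<longlonglongrightarrow> entropy (orbit_closure k x)"
  proof -
    have "strict_mono (\<lambda>c. c * L)" using \<open>L > 0\<close> by (simp add: strict_mono_def)
    from LIMSEQ_subseq_LIMSEQ[OF entropy_limit[OF x] this] show ?thesis by (simp add: o_def)
  qed
  have ub: "(\<lambda>c. (ln (real L) + ln (real (card V))) / real L * (1 / real c) + ln (real (card V)) / real L)
          \<longlonglongrightarrow> (ln (real L) + ln (real (card V))) / real L * 0 + ln (real (card V)) / real L"
    by (rule tendsto_add[OF tendsto_mult[OF tendsto_const lim_1_over_n] tendsto_const])
  have "entropy (orbit_closure k x)
      \<le> (ln (real L) + ln (real (card V))) / real L * 0 + ln (real (card V)) / real L"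
  proof (rule LIMSEQ_le[OF sub ub], intro exI[of _ 1] allI impI)
    fix c :: nat assume c: "c \<ge> 1"
    have "real (card (range (\<lambda>m. factor x m (c * L)))) \<le> real L * real (card V) ^ Suc c"
      using bound[of c] by (metis of_nat_le_iff of_nat_mult of_nat_power)
    then have "ln (real (card (range (\<lambda>m. factor x m (c * L))))) \<le> ln (real L * real (card V) ^ Suc c)"
      using card_factors_pos[OF x, of "c * L"] Vpos \<open>L > 0\<close> by (subst ln_le_cancel_iff) auto
    also have "\<dots> = ln (real L) + (real c + 1) * ln (real (card V))"
      using Vpos \<open>L > 0\<close> by (simp add: ln_mult ln_realpow algebra_simps del: power_Suc)
    finally have le: "ln (real (card (range (\<lambda>m. factor x m (c * L))))) / real (c * L)
      \<le> (ln (real L) + (real c + 1) * ln (real (card V))) / real (c * L)"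
      by (rule divide_right_mono) simp
    have alg: "(p + (real c + 1) * q) / real (c * L) = (p + q) / real L * (1 / real c) + q / real L"
      for p q :: real
      using c \<open>L > 0\<close> by (simp add: field_simps)
    show "ln (real (card (range (\<lambda>m. factor x m (c * L))))) / real (c * L)
      \<le> (ln (real L) + ln (real (card V))) / real L * (1 / real c) + ln (real (card V)) / real L"
      using le unfolding alg .
  qed
  then show ?thesis unfolding V_def mult_zero_right add_0 .
qed

section \<open>Sums over centred cells\<close>

text \<open>
  With \<open>l = 2 * h + 1\<close>, the cell with index \<open>t\<close> is \<open>{t * l - h..t * l + h}\<close>, and the cell containing \<open>n\<close>
  has index \<open>(n + h) div l\<close>.
\<close>

lemma int_div_eqI:
  fixes n t L :: int
  assumes "t * L \<le> n" "n < (t + 1) * L"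
  shows "n div L = t"
proof -
  have "L > 0" using assms by (simp add: algebra_simps)
  have "n = L * t + (n - L * t)" by simp
  moreover have "0 \<le> n - L * t" "n - L * t < L" using assms by (auto simp: algebra_simps)
  ultimately show ?thesis using int_div_pos_eq by blast
qed

lemma cell_index:
  fixes h t i :: int
  assumes "-h \<le> i" "i \<le> h"
  shows "(t * (2 * h + 1) + i + h) div (2 * h + 1) = t"
  by (rule int_div_eqI) (use assms in \<open>auto simp: algebra_simps\<close>)

lemma cell_offset:
  fixes h n :: int
  assumes "h \<ge> 0"
  obtains i where "n = (n + h) div (2 * h + 1) * (2 * h + 1) + i" "-h \<le> i" "i \<le> h"
proof
  let ?i = "(n + h) mod (2 * h + 1) - h"
  show "n = (n + h) div (2 * h + 1) * (2 * h + 1) + ?i"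
    using div_mult_mod_eq[of "n + h" "2 * h + 1"] by linarith
  show "-h \<le> ?i" "?i \<le> h" using assms pos_mod_sign[of "2*h+1" "n+h"] pos_mod_bound[of "2*h+1" "n+h"]
    by linarith+
qed

lemma cell_index_bounds:
  fixes h n c :: int
  assumes h: "h \<ge> 0" and n: "-(c * (2 * h + 1) + h) \<le> n" "n \<le> c * (2 * h + 1) + h"
  shows "-c \<le> (n + h) div (2 * h + 1)" "(n + h) div (2 * h + 1) \<le> c"
proof -
  define t where "t = (n + h) div (2 * h + 1)"
  obtain i where ni: "n = t * (2 * h + 1) + i" and i: "-h \<le> i" "i \<le> h"
    using cell_offset[OF h] unfolding t_def by blast
  have "t * (2 * h + 1) < (c + 1) * (2 * h + 1)" using n i ni by (simp add: algebra_simps)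
  then have "t < c + 1" using h by (simp add: mult_less_cancel_right)
  then show "(n + h) div (2 * h + 1) \<le> c" by (simp add: t_def)
  have "(- c - 1) * (2 * h + 1) < t * (2 * h + 1)" using n i ni by (simp add: algebra_simps)
  then have "- c - 1 < t" using h by (simp add: mult_less_cancel_right)
  then show "-c \<le> (n + h) div (2 * h + 1)" by (simp add: t_def)
qed

lemma sum_cells:
  fixes f :: "int \<Rightarrow> 'b::comm_monoid_add"
  assumes h: "h \<ge> 0"
  shows "(\<Sum>n=-(c * (2 * h + 1) + h)..c * (2 * h + 1) + h. f n)
       = (\<Sum>t=-c..c. \<Sum>i=-h..h. f (t * (2 * h + 1) + i))"
proof -
  let ?l = "2 * h + 1"
  have "(\<Sum>n=-(c * ?l + h)..c * ?l + h. f n)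
      = (\<Sum>(t, i)\<in>{-c..c} \<times> {-h..h}. f (t * ?l + i))"
  proof (rule sum.reindex_bij_witness[where j = "\<lambda>n. ((n + h) div ?l, (n + h) mod ?l - h)"
        and i = "\<lambda>(t, i). t * ?l + i"])
    fix n assume n: "n \<in> {-(c * ?l + h)..c * ?l + h}"
    show eq: "(case ((n + h) div ?l, (n + h) mod ?l - h) of (t, i) \<Rightarrow> t * ?l + i) = n"
      using div_mult_mod_eq[of "n + h" ?l] by simp
    have "(n + h) mod ?l < ?l" "0 \<le> (n + h) mod ?l"
      using h pos_mod_bound[of ?l "n + h"] pos_mod_sign[of ?l "n + h"] by linarith+
    moreover have "- h \<le> (n + h) mod ?l - h" "(n + h) mod ?l - h \<le> h" using calculation by linarith+
    ultimately show "((n + h) div ?l, (n + h) mod ?l - h) \<in> {-c..c} \<times> {-h..h}"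
      using cell_index_bounds[OF h, of c n] n by (simp only: atLeastAtMost_iff mem_Times_iff fst_conv snd_conv)
    show "(case ((n + h) div ?l, (n + h) mod ?l - h) of (t, i) \<Rightarrow> f (t * ?l + i)) = f n"
      using eq by (simp only: prod.case)
  next
    fix y assume y: "y \<in> {-c..c} \<times> {-h..h}"
    obtain t i where ti: "y = (t, i)" by (cases y)
    have i: "-h \<le> i" "i \<le> h" and t: "-c \<le> t" "t \<le> c" using y ti by auto
    have d: "(t * ?l + i + h) div ?l = t" by (rule cell_index[OF i])
    have "(t * ?l + i + h) mod ?l = i + h"
      using div_mult_mod_eq[of "t * ?l + i + h" ?l] unfolding d by linarith
    with d ti show "(((case y of (t, i) \<Rightarrow> t * ?l + i) + h) div ?l,
        ((case y of (t, i) \<Rightarrow> t * ?l + i) + h) mod ?l - h) = y" by simp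
    have "t * ?l \<le> c * ?l" "(-c) * ?l \<le> t * ?l" using t h by (intro mult_right_mono; simp)+
    then show "(case y of (t, i) \<Rightarrow> t * ?l + i) \<in> {-(c * ?l + h)..c * ?l + h}"
      unfolding ti prod.case atLeastAtMost_iff using i by (simp only: mult_minus_left) linarith
  qed
  then show ?thesis by (simp add: sum.cartesian_product)
qed

section \<open>The hierarchical construction\<close>

text \<open>
  The first element takes the least amount that leaves a feasible total to the others.
\<close>
lemma exists_budget:
  fixes lo hi T :: int
  assumes "finite A" "int (card A) * lo \<le> T" "T \<le> int (card A) * hi" "lo \<le> hi"
  shows "\<exists>d. (\<forall>t\<in>A. lo \<le> d t \<and> d t \<le> hi) \<and> sum d A = T"
  using assms
proof (induction A arbitrary: T rule: finite_induct)
  case (insert x A)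
  define y where "y = max lo (T - int (card A) * hi)"
  have y: "lo \<le> y" "y \<le> hi" "int (card A) * lo \<le> T - y" "T - y \<le> int (card A) * hi"
  proof -
    have "int (card (insert x A)) * z = int (card A) * z + z" for z
      using insert.hyps by (simp add: algebra_simps)
    note this[of lo] this[of hi]
    moreover have "int (card A) * lo \<le> int (card A) * hi"
      using insert.prems by (intro mult_left_mono) auto
    ultimately show "lo \<le> y" "y \<le> hi" "int (card A) * lo \<le> T - y" "T - y \<le> int (card A) * hi"
      using insert.prems unfolding y_def by linarith+
  qed
  obtain d where d: "\<forall>t\<in>A. lo \<le> d t \<and> d t \<le> hi" "sum d A = T - y"
    using insert.IH[OF y(3,4) insert.prems(3)] by blast
  have "sum (d(x := y)) A = sum d A"
    by (rule sum.cong) (use insert.hyps in auto)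
  then have "sum (d(x := y)) (insert x A) = T"
    using insert.hyps d(2) by simp
  moreover have "\<forall>t\<in>insert x A. lo \<le> (d(x := y)) t \<and> (d(x := y)) t \<le> hi"
    using d(1) y by simp
  ultimately show ?case by blast
qed auto

locale toeplitz_approximation =
  fixes k :: nat and K :: int and a :: "int \<Rightarrow> nat"
  assumes k2: "k \<ge> 2" and K: "int k \<le> K" and a: "a \<in> topspace (full_shift k)"
begin

text \<open>
  Half-lengths of the cells: a cell of level \<open>j\<close> has length \<open>len j = 2 * half j + 1\<close>, and
  \<open>radius j\<close> subcells lie on either side of the middle one in a cell of level \<open>j + 1\<close>. The
  factor \<open>len j\<close> inside \<open>radius j\<close> makes the proportion of middle subcells summable over the
  levels, and \<open>K\<close> makes its sum small.
\<close>
primrec half :: "nat \<Rightarrow> int" where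
  "half 0 = 0"
| "half (Suc j) = K * (2 * half j + 1) * (2 * half j + 1) + half j"

abbreviation len :: "nat \<Rightarrow> int" where
  "len j \<equiv> 2 * half j + 1"

definition radius :: "nat \<Rightarrow> int" where
  "radius j = K * len j"

text \<open>
  The errors that can be prescribed for a cell of level \<open>j\<close> are those in
  \<open>{lo j..lo j + gap j}\<close>. The middle subcell of a cell of level \<open>j + 1\<close> makes an unknown error
  between \<open>0\<close> and \<open>k * len j\<close>. Adding \<open>k * len j\<close> to the lower bound ensures that the others
  are left with at least \<open>lo j\<close> each. The upper bounds of the others leave a slack of
  \<open>2 * radius j * gap j\<close>, half of which absorbs the same unknown, the other half being the new
  gap.
\<close>
primrec lo :: "nat \<Rightarrow> int" where
  "lo 0 = 0"
| "lo (Suc j) = 2 * radius j * lo j + int k * len j"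

primrec gap :: "nat \<Rightarrow> int" where
  "gap 0 = 1"
| "gap (Suc j) = radius j * gap j"

definition err :: "(int \<Rightarrow> nat) \<Rightarrow> (int \<Rightarrow> nat) \<Rightarrow> int \<Rightarrow> int" where
  "err w x h = (\<Sum>i=-h..h. \<bar>int (w i) - int (x i)\<bar>)"

text \<open>
  Some symbol of \<open>{1..k}\<close> at distance exactly \<open>1\<close>, using \<open>2 \<le> k\<close>.
\<close>
definition neighbour :: "nat \<Rightarrow> nat" where
  "neighbour c = (if c = 1 then 2 else c - 1)"

definition budget :: "nat \<Rightarrow> int \<Rightarrow> int \<Rightarrow> int" where
  "budget j T = (SOME d. (\<forall>t\<in>{-radius j..radius j} - {0}. lo j \<le> d t \<and> d t \<le> lo j + gap j)
     \<and> sum d ({-radius j..radius j} - {0}) = T)"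

text \<open>
  \<open>fill j w s\<close> is a copy of \<open>w\<close> on the cell \<open>{- half j..half j}\<close>, with error \<open>s\<close> if \<open>s\<close> is
  one of the errors that can be prescribed. The middle subcell is taken from \<open>a\<close> itself rather than from
  \<open>w\<close>, with the least error that can be prescribed, so it is the same in all copies.
\<close>
primrec fill :: "nat \<Rightarrow> (int \<Rightarrow> nat) \<Rightarrow> int \<Rightarrow> int \<Rightarrow> nat" where
  "fill 0 = (\<lambda>w s n. if s = 0 then w n else neighbour (w n))"
| "fill (Suc j) = (\<lambda>w s n.
     let t = (n + half j) div len j in
     if t = 0 then fill j a (lo j) n
     else fill j (shift_pow (t * len j) w) (budget j (s - err w (fill j a (lo j)) (half j)) t)
            (n - t * len j))"

lemma half_Suc: "half (Suc j) = radius j * len j + half j"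
  by (simp add: radius_def)

lemma len_Suc: "len (Suc j) = (2 * radius j + 1) * len j"
  unfolding half_Suc by (simp add: algebra_simps)

declare half.simps(2) [simp del]

lemma K_ge: "K \<ge> 2"
  using k2 K by linarith

lemma half_ge: "int j \<le> half j"
proof (induction j)
  case (Suc j)
  have "2 * 1 \<le> K * len j" using Suc K_ge by (intro mult_mono) auto
  then have "1 * 1 \<le> radius j * len j" unfolding radius_def using Suc by (intro mult_mono) auto
  then show ?case unfolding half_Suc using Suc by simp
qed simp

lemma half_nonneg [simp]: "0 \<le> half j"
  using half_ge[of j] by linarith

lemma len_le_radius: "len j \<le> radius j"
proof -
  have "1 * len j \<le> K * len j" using K_ge half_nonneg[of j] by (intro mult_right_mono) auto
  then show ?thesis by (simp add: radius_def)
qed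

lemma radius_pos: "radius j \<ge> 1"
  using len_le_radius[of j] half_nonneg[of j] by linarith

lemma half_Suc_less: "half j < half (Suc j)"
proof -
  have "1 * 1 \<le> radius j * len j" using radius_pos[of j] by (intro mult_mono) auto
  then show ?thesis unfolding half_Suc by simp
qed

lemma half_mono: "i \<le> j \<Longrightarrow> half i \<le> half j"
  by (rule lift_Suc_mono_le[of half]) (use half_Suc_less less_imp_le in blast)+

lemma gap_pos: "gap j \<ge> 1"
proof (induction j)
  case (Suc j)
  have "1 * 1 \<le> radius j * gap j" using radius_pos[of j] Suc by (intro mult_mono) auto
  then show ?case by simp
qed simp

lemma lo_nonneg: "lo j \<ge> 0"
proof (induction j)
  case (Suc j)
  then show ?case using radius_pos[of j] by simp
qed simp

subsection \<open>Errors can be prescribed\<close>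

lemma shift_pow_topspace:
  "w \<in> topspace (full_shift k) \<Longrightarrow> shift_pow m w \<in> topspace (full_shift k)"
  by (simp add: topspace_full_shift shift_pow_def)

lemma fill_topspace:
  "w \<in> topspace (full_shift k) \<Longrightarrow> fill j w s \<in> topspace (full_shift k)"
proof (induction j arbitrary: w s)
  case 0
  have "neighbour c \<in> {1..k}" if "c \<in> {1..k}" for c
    using that k2 by (auto simp: neighbour_def)
  then show ?case using 0 unfolding topspace_full_shift by simp
next
  case (Suc j)
  have "fill (Suc j) w s n \<in> {1..k}" for n
    using Suc.IH[OF a] Suc.IH[OF shift_pow_topspace[OF Suc.prems]]
    unfolding topspace_full_shift by (simp add: Let_def)
  then show ?case by (simp add: topspace_full_shift)
qed

lemma fill_Suc_centre:
  assumes "-half j \<le> i" "i \<le> half j"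
  shows "fill (Suc j) w s i = fill j a (lo j) i"
  using cell_index[OF assms, of 0] by (simp add: Let_def)

lemma fill_Suc_cell:
  assumes "-half j \<le> i" "i \<le> half j" "t \<noteq> 0"
  shows "fill (Suc j) w s (t * len j + i)
    = fill j (shift_pow (t * len j) w) (budget j (s - err w (fill j a (lo j)) (half j)) t) i"
  using cell_index[OF assms(1,2), of t] assms(3) by (simp add: Let_def)

text \<open>
  Copying is local: the budgets depend on \<open>w\<close> only through its error against the middle subcell.
  This is what allows counting cell contents by the words of \<open>a\<close>.
\<close>
lemma fill_cong:
  assumes "\<And>i. -half j \<le> i \<Longrightarrow> i \<le> half j \<Longrightarrow> w i = w' i" "-half j \<le> n" "n \<le> half j"
  shows "fill j w s n = fill j w' s n"
  using assms
proof (induction j arbitrary: w w' s n)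
  case 0
  then show ?case by simp
next
  case (Suc j)
  define t where "t = (n + half j) div len j"
  obtain i where n: "n = t * len j + i" and i: "-half j \<le> i" "i \<le> half j"
    using cell_offset[OF half_nonneg[of j], of n] unfolding t_def by blast
  have t: "-radius j \<le> t" "t \<le> radius j"
    unfolding t_def using cell_index_bounds[OF half_nonneg] Suc.prems(2,3) unfolding half_Suc by blast+
  have "t * len j \<le> radius j * len j" "(-radius j) * len j \<le> t * len j"
    using t half_nonneg[of j] by (intro mult_right_mono; simp)+
  then have inside: "-half (Suc j) \<le> t * len j + i'" "t * len j + i' \<le> half (Suc j)"
    if "-half j \<le> i'" "i' \<le> half j" for i'
    unfolding half_Suc using that by (simp_all only: mult_minus_left)
  show ?case
  proof (cases "t = 0")
    case True
    then show ?thesis using n fill_Suc_centre[OF i] by simp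
  next
    case False
    have "err w (fill j a (lo j)) (half j) = err w' (fill j a (lo j)) (half j)"
      unfolding err_def
      by (rule sum.cong) (use Suc.prems(1) half_Suc_less[of j] in auto)
    moreover have "fill j (shift_pow (t * len j) w) s' i = fill j (shift_pow (t * len j) w') s' i" for s'
    proof (rule Suc.IH[OF _ i])
      fix i' assume i': "-half j \<le> i'" "i' \<le> half j"
      show "shift_pow (t * len j) w i' = shift_pow (t * len j) w' i'"
        using Suc.prems(1)[OF inside[OF i']] by (simp add: shift_pow_def add.commute)
    qed
    ultimately show ?thesis unfolding n fill_Suc_cell[OF i False] by simp
  qed
qed

lemma abs_diff_symbols:
  assumes "w \<in> topspace (full_shift k)" "x \<in> topspace (full_shift k)"
  shows "\<bar>int (w i) - int (x i)\<bar> \<le> int k"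
proof -
  have "w i \<le> k" "x i \<le> k" using assms by (auto simp: topspace_full_shift)
  then show ?thesis by linarith
qed

lemma err_bounds:
  assumes "w \<in> topspace (full_shift k)" "x \<in> topspace (full_shift k)" "h \<ge> 0"
  shows "0 \<le> err w x h" "err w x h \<le> int k * (2 * h + 1)"
proof -
  show "0 \<le> err w x h" unfolding err_def by (rule sum_nonneg) simp
  have "err w x h \<le> of_nat (card {-h..h}) * int k"
    unfolding err_def using abs_diff_symbols[OF assms(1,2)] by (intro sum_bounded_above) auto
  also have "\<dots> = int k * (2 * h + 1)" using assms(3) by simp
  finally show "err w x h \<le> int k * (2 * h + 1)" .
qed

text \<open>
  Whatever error the middle subcell makes, the remaining total \<open>T\<close> can be distributed, because
  \<open>k * len j \<le> radius j * gap j\<close>; this inequality uses \<open>k \<le> K\<close>.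
\<close>
lemma budget_feasible:
  assumes w: "w \<in> topspace (full_shift k)" and s: "lo (Suc j) \<le> s" "s \<le> lo (Suc j) + gap (Suc j)"
  defines "T \<equiv> s - err w (fill j a (lo j)) (half j)"
  shows "t \<noteq> 0 \<Longrightarrow> -radius j \<le> t \<Longrightarrow> t \<le> radius j \<Longrightarrow> lo j \<le> budget j T t \<and> budget j T t \<le> lo j + gap j"
    and "sum (budget j T) ({-radius j..radius j} - {0}) = T"
proof -
  let ?I = "{-radius j..radius j} - {0}"
  have card: "int (card ?I) = 2 * radius j"
    using radius_pos[of j] by (simp add: card_Diff_singleton)
  have e: "0 \<le> err w (fill j a (lo j)) (half j)" "err w (fill j a (lo j)) (half j) \<le> int k * len j"
    using err_bounds[OF w fill_topspace[OF a]] half_nonneg by auto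
  have "int k * len j \<le> radius j" unfolding radius_def using K by (intro mult_right_mono) auto
  also have "radius j * 1 \<le> radius j * gap j" using gap_pos[of j] radius_pos[of j] by (intro mult_left_mono) auto
  finally have "int k * len j \<le> radius j * gap j" by simp
  then have "2 * radius j * lo j \<le> T" "T \<le> 2 * radius j * (lo j + gap j)"
    using e s by (simp_all add: T_def algebra_simps)
  then have "\<exists>d. (\<forall>t\<in>?I. lo j \<le> d t \<and> d t \<le> lo j + gap j) \<and> sum d ?I = T"
    using gap_pos[of j] by (intro exists_budget) (simp_all add: card)
  from someI_ex[OF this, folded budget_def]
  show "t \<noteq> 0 \<Longrightarrow> -radius j \<le> t \<Longrightarrow> t \<le> radius j \<Longrightarrow> lo j \<le> budget j T t \<and> budget j T t \<le> lo j + gap j"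
    "sum (budget j T) ?I = T" by auto
qed

text \<open>
  By induction over the levels, each subcell spends exactly its budget, and the budgets together
  with the error of the middle subcell add up to \<open>s\<close>.
\<close>
lemma err_fill:
  assumes "w \<in> topspace (full_shift k)" "lo j \<le> s" "s \<le> lo j + gap j"
  shows "err w (fill j w s) (half j) = s"
  using assms
proof (induction j arbitrary: w s)
  case 0
  have "w 0 \<ge> 1" using 0 by (auto simp: topspace_full_shift)
  moreover have "s = 0 \<or> s = 1" using 0 by auto
  ultimately show ?case by (auto simp: err_def neighbour_def)
next
  case (Suc j)
  let ?r = "radius j" and ?h = "half j"
  let ?e = "err w (fill j a (lo j)) ?h"
  let ?cell = "\<lambda>t. \<Sum>i=-?h..?h. \<bar>int (w (t * len j + i)) - int (fill (Suc j) w s (t * len j + i))\<bar>"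
  have "err w (fill (Suc j) w s) (half (Suc j)) = (\<Sum>t=-?r..?r. ?cell t)"
    unfolding err_def half_Suc by (rule sum_cells) simp
  also have "\<dots> = ?cell 0 + sum ?cell ({-?r..?r} - {0})"
    using radius_pos[of j] by (intro sum.remove) auto
  also have "?cell 0 = ?e"
    unfolding err_def by (rule sum.cong) (auto simp: fill_Suc_centre)
  also have "sum ?cell ({-?r..?r} - {0}) = sum (budget j (s - ?e)) ({-?r..?r} - {0})"
  proof (rule sum.cong[OF refl])
    fix t assume "t \<in> {-?r..?r} - {0}"
    then have t: "t \<noteq> 0" "-?r \<le> t" "t \<le> ?r" by auto
    have "?cell t = err (shift_pow (t * len j) w)
        (fill j (shift_pow (t * len j) w) (budget j (s - ?e) t)) ?h"
      unfolding err_def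
      by (rule sum.cong[OF refl])
        (subst fill_Suc_cell, use t(1) in \<open>auto simp: err_def shift_pow_def add.commute\<close>)
    also have "\<dots> = budget j (s - ?e) t"
      using budget_feasible(1)[OF Suc.prems t] by (intro Suc.IH shift_pow_topspace Suc.prems(1)) auto
    finally show "?cell t = budget j (s - ?e) t" .
  qed
  also have "\<dots> = s - ?e" by (rule budget_feasible(2)[OF Suc.prems])
  finally show ?case by simp
qed

subsection \<open>The Toeplitz sequence\<close>

text \<open>
  The fillings of the cells around \<open>0\<close> extend each other, so position \<open>n\<close> can be read off on any
  level \<open>j\<close> with \<open>\<bar>n\<bar> \<le> half j\<close>; level \<open>\<bar>n\<bar>\<close> is such a level.
\<close>
definition limit :: "int \<Rightarrow> nat" where
  "limit n = fill (nat \<bar>n\<bar>) a (lo (nat \<bar>n\<bar>)) n"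

lemma limit_topspace: "limit \<in> topspace (full_shift k)"
  using fill_topspace[OF a] unfolding topspace_full_shift limit_def by simp

lemma limit_eq:
  assumes "-half j \<le> n" "n \<le> half j"
  shows "limit n = fill j a (lo j) n"
proof -
  have stable: "fill j' a (lo j') n = fill i a (lo i) n"
    if "i \<le> j'" "-half i \<le> n" "n \<le> half i" for i j'
    using that(1)
  proof (induction j' rule: dec_induct)
    case (step j')
    have "half i \<le> half j'" using step.hyps by (intro half_mono) simp
    then have "fill (Suc j') a (lo (Suc j')) n = fill j' a (lo j') n"
      using that by (intro fill_Suc_centre) auto
    with step.IH show ?case by simp
  qed simp
  let ?i = "nat \<bar>n\<bar>"
  have "-half ?i \<le> n" "n \<le> half ?i" using half_ge[of ?i] by auto
  then show ?thesis
    using stable[of ?i "max ?i j"] stable[of j "max ?i j"] assms by (simp add: limit_def)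
qed

text \<open>
  The cell \<open>t\<close> of \<open>limit\<close> is a copy of the cell \<open>m\<close> of \<open>a\<close>. Here \<open>m\<close> can differ from
  \<open>t\<close>: copies of a cell around \<open>0\<close>, and everything inside them, are modelled on \<open>a\<close> near \<open>0\<close>.
\<close>
definition modelled :: "nat \<Rightarrow> int \<Rightarrow> int \<Rightarrow> bool" where
  "modelled j t m \<longleftrightarrow> (\<exists>s. lo j \<le> s \<and> s \<le> lo j + gap j \<and>
     (\<forall>i. -half j \<le> i \<longrightarrow> i \<le> half j \<longrightarrow>
        limit (t * len j + i) = fill j (shift_pow (m * len j) a) s i))"

lemma modelled_0: "modelled j 0 0"
  unfolding modelled_def using gap_pos[of j]
  by (intro exI[of _ "lo j"]) (auto simp: limit_eq shift_pow_def)

lemma modelled_centre: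
  assumes "modelled (Suc j) T m" "-half j \<le> i" "i \<le> half j"
  shows "limit (T * len (Suc j) + i) = limit i"
proof -
  obtain s where "\<And>i. -half (Suc j) \<le> i \<Longrightarrow> i \<le> half (Suc j) \<Longrightarrow>
      limit (T * len (Suc j) + i) = fill (Suc j) (shift_pow (m * len (Suc j)) a) s i"
    using assms(1) unfolding modelled_def by blast
  then have "limit (T * len (Suc j) + i) = fill (Suc j) (shift_pow (m * len (Suc j)) a) s i"
    using assms(2,3) half_Suc_less[of j] by simp
  also have "\<dots> = limit i"
    using fill_Suc_centre[OF assms(2,3)] limit_eq[OF assms(2,3)] by simp
  finally show ?thesis .
qed

lemma modelled_sub:
  assumes "modelled (Suc j) T m" and u: "u \<noteq> 0" "-radius j \<le> u" "u \<le> radius j"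
  shows "modelled j (T * (2 * radius j + 1) + u) (m * (2 * radius j + 1) + u)"
proof -
  let ?w = "shift_pow (m * len (Suc j)) a" and ?q = "2 * radius j + 1"
  obtain s where s: "lo (Suc j) \<le> s" "s \<le> lo (Suc j) + gap (Suc j)"
    and eq: "\<And>i. -half (Suc j) \<le> i \<Longrightarrow> i \<le> half (Suc j) \<Longrightarrow>
      limit (T * len (Suc j) + i) = fill (Suc j) ?w s i"
    using assms(1) unfolding modelled_def by blast
  define s' where "s' = budget j (s - err ?w (fill j a (lo j)) (half j)) u"
  have s': "lo j \<le> s'" "s' \<le> lo j + gap j"
    using budget_feasible(1)[OF shift_pow_topspace[OF a] s u] unfolding s'_def by auto
  have "u * len j \<le> radius j * len j" "(-radius j) * len j \<le> u * len j"
    using u half_nonneg[of j] by (intro mult_right_mono; simp)+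
  then have inside: "-half (Suc j) \<le> u * len j + i" "u * len j + i \<le> half (Suc j)"
    if "-half j \<le> i" "i \<le> half j" for i
    unfolding half_Suc using that by (simp_all only: mult_minus_left)
  have pos: "(x * ?q + u) * len j = x * len (Suc j) + u * len j" for x
    unfolding len_Suc by (simp only: distrib_right mult.assoc)
  have "limit ((T * ?q + u) * len j + i) = fill j (shift_pow ((m * ?q + u) * len j) a) s' i"
    if i: "-half j \<le> i" "i \<le> half j" for i
  proof -
    have "limit ((T * ?q + u) * len j + i) = fill (Suc j) ?w s (u * len j + i)"
      using eq[OF inside[OF i]] by (simp only: pos add.assoc)
    also have "\<dots> = fill j (shift_pow (u * len j) ?w) s' i"
      unfolding s'_def by (rule fill_Suc_cell[OF i u(1)])
    also have "shift_pow (u * len j) ?w = shift_pow ((m * ?q + u) * len j) a"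
      unfolding pos by (simp add: shift_pow_def ac_simps)
    finally show ?thesis .
  qed
  with s' show ?thesis unfolding modelled_def by blast
qed

text \<open>
  The cell \<open>t\<close> is a subcell of a cell \<open>T\<close> of the next level, which is closer to \<open>0\<close> in units of
  its own length, so the claim descends from cells around \<open>0\<close> on high levels.
\<close>
lemma exists_modelled: "\<exists>m. modelled j t m"
proof (induction "nat \<bar>t\<bar>" arbitrary: j t rule: less_induct)
  case less
  show ?case
  proof (cases "t = 0")
    case True
    then show ?thesis using modelled_0 by blast
  next
    case False
    let ?r = "radius j"
    define T where "T = (t + ?r) div (2 * ?r + 1)"
    have r: "?r \<ge> 1" by (rule radius_pos)
    obtain u where t: "t = T * (2 * ?r + 1) + u" and u: "-?r \<le> u" "u \<le> ?r"
      using cell_offset[of ?r t] r unfolding T_def by auto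
    have "\<bar>T\<bar> < \<bar>t\<bar>"
    proof (cases "T = 0")
      case False
      have "\<bar>T\<bar> * (2 * ?r + 1) = \<bar>t - u\<bar>" using t r by (simp add: abs_mult)
      then have "\<bar>T\<bar> * (2 * ?r + 1) \<le> \<bar>t\<bar> + \<bar>u\<bar>" by linarith
      moreover have "\<bar>T\<bar> * (2 * ?r + 1) = \<bar>T\<bar> + 2 * (\<bar>T\<bar> * ?r)" by (simp add: algebra_simps)
      moreover have "1 * ?r \<le> \<bar>T\<bar> * ?r" using False r by (intro mult_right_mono) auto
      ultimately show ?thesis using u r by linarith
    qed (use \<open>t \<noteq> 0\<close> in simp)
    then have "nat \<bar>T\<bar> < nat \<bar>t\<bar>" by linarith
    from less[OF this] obtain m where m: "modelled (Suc j) T m" by blast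
    show ?thesis
    proof (cases "u = 0")
      case True
      have "limit (t * len j + i) = limit i" if "-half j \<le> i" "i \<le> half j" for i
        using modelled_centre[OF m that] unfolding t True len_Suc by (simp add: mult.assoc)
      then have "modelled j t 0"
        using modelled_0[of j] unfolding modelled_def by simp
      then show ?thesis ..
    next
      case False
      then show ?thesis using modelled_sub[OF m False u] t by blast
    qed
  qed
qed

lemma limit_periodic:
  assumes "-half j \<le> i" "i \<le> half j"
  shows "limit (T * len (Suc j) + i) = limit i"
  using exists_modelled[of "Suc j" T] modelled_centre[OF _ assms] by blast

text \<open>
  A neighbourhood of \<open>limit\<close> constrains finitely many positions only; these lie in some cell
  around \<open>0\<close>, whose content recurs periodically by \<open>limit_periodic\<close>.
\<close>
lemma toeplitz_limit: "toeplitz k limit"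
  unfolding toeplitz_def regularly_recurrent_def
proof (intro conjI allI impI limit_topspace, elim conjE)
  fix U assume U: "openin (full_shift k) U" and "limit \<in> U"
  then obtain X where X: "limit \<in> PiE UNIV X" "finite {i. X i \<noteq> {1..k}}" "PiE UNIV X \<subseteq> U"
    using product_topology_open_contains_basis[of "\<lambda>_. discrete_topology {1..k}" UNIV U limit]
    unfolding full_shift_def by auto
  obtain B where "abs ` {i. X i \<noteq> {1..k}} \<subseteq> {..B}"
    using X(2) unfolding finite_int_iff_bounded_le by (elim exE)
  then have B: "\<bar>i\<bar> \<le> B" if "X i \<noteq> {1..k}" for i using that by blast
  define j where "j = nat B"
  have "shift_pow m limit \<in> U" if m: "len (Suc j) dvd m" for m
  proof -
    obtain T where T: "m = T * len (Suc j)" using m by (metis dvd_def mult.commute)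
    have "limit (i + m) \<in> X i" for i
    proof (cases "X i = {1..k}")
      case True
      then show ?thesis using limit_topspace by (simp add: topspace_full_shift)
    next
      case False
      moreover have "B \<le> int j" by (simp add: j_def)
      ultimately have "\<bar>i\<bar> \<le> half j" using B[of i] half_ge[of j] by linarith
      then have "limit (i + m) = limit i" using limit_periodic[of j i T] by (simp add: T add.commute)
      then show ?thesis using X(1) by auto
    qed
    then show ?thesis using X(3) by (auto simp: shift_pow_def PiE_iff)
  qed
  moreover have "len (Suc j) > 0" using half_nonneg[of "Suc j"] by linarith
  ultimately show "\<exists>l>0. \<forall>m. l dvd m \<longrightarrow> shift_pow m limit \<in> U" by blast
qed

subsection \<open>Entropy of the Toeplitz sequence\<close>

definition width :: "nat \<Rightarrow> nat" where
  "width j = nat (len j)"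

lemma int_width: "int (width j) = len j"
  using half_nonneg[of j] by (simp add: width_def)

lemma width_pos: "width j > 0"
  using int_width[of j] half_nonneg[of j] by linarith

lemma strict_mono_width: "strict_mono width"
proof (rule strict_monoI_Suc)
  show "width j < width (Suc j)" for j
    using half_Suc_less[of j] int_width[of j] int_width[of "Suc j"] by linarith
qed

text \<open>
  The gap is multiplied by \<open>radius j\<close> and the length by more than \<open>2 * radius j\<close>, so the gap
  relative to the length is at least halved on each level.
\<close>
lemma gap_halves: "gap j * 2 ^ j \<le> len j"
proof (induction j)
  case (Suc j)
  have "gap (Suc j) * 2 ^ Suc j = 2 * radius j * (gap j * 2 ^ j)" by simp
  also have "\<dots> \<le> 2 * radius j * len j" using Suc radius_pos[of j] by (intro mult_left_mono) auto
  also have "\<dots> \<le> len (Suc j)" unfolding len_Suc using half_nonneg[of j] by (simp add: algebra_simps)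
  finally show ?case .
qed simp

lemma gap_le_len: "gap j \<le> len j"
proof -
  have "gap j * 1 \<le> gap j * 2 ^ j" using gap_pos[of j] by (intro mult_left_mono) auto
  then show ?thesis using gap_halves[of j] by linarith
qed

text \<open>
  A cell content is a function of the word of \<open>a\<close> it copies and of its error \<open>s\<close>; there are
  \<open>gap j + 1 \<le> 2 * width j\<close> possible errors.
\<close>
lemma card_cells:
  "card (range (\<lambda>t. factor limit (t * len j - half j) (width j)))
     \<le> card (range (\<lambda>m. factor a m (width j))) * (2 * width j)"
proof -
  let ?A = "range (\<lambda>m. factor a m (width j))" and ?S = "{lo j..lo j + gap j}"
  let ?g = "\<lambda>(u, s). factor (fill j (\<lambda>n. u ! nat (n + half j)) s) (- half j) (width j)"
  have "factor limit (t * len j - half j) (width j) \<in> ?g ` (?A \<times> ?S)" for t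
  proof -
    obtain m s where s: "s \<in> ?S"
      and eq: "\<And>i. -half j \<le> i \<Longrightarrow> i \<le> half j \<Longrightarrow>
        limit (t * len j + i) = fill j (shift_pow (m * len j) a) s i"
      using exists_modelled[of j t] unfolding modelled_def by auto
    define u where "u = factor a (m * len j - half j) (width j)"
    have "factor limit (t * len j - half j) (width j) = ?g (u, s)"
      unfolding factor_def prod.case
    proof (rule map_cong[OF refl])
      fix i assume "i \<in> set [0..<width j]"
      then have i: "-half j \<le> int i - half j" "int i - half j \<le> half j"
        using int_width[of j] by auto
      have "limit (t * len j - half j + int i) = fill j (shift_pow (m * len j) a) s (int i - half j)"
        using eq[OF i] by (simp add: algebra_simps)
      also have "\<dots> = fill j (\<lambda>n. u ! nat (n + half j)) s (int i - half j)"
      proof (rule fill_cong[OF _ i])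
        fix n assume n: "-half j \<le> n" "n \<le> half j"
        then have "nat (n + half j) < width j" using int_width[of j] by linarith
        then show "shift_pow (m * len j) a n = u ! nat (n + half j)"
          using n by (simp add: u_def factor_def shift_pow_def add.commute)
      qed
      finally show "limit (t * len j - half j + int i)
          = fill j (\<lambda>n. u ! nat (n + half j)) s (- half j + int i)"
        by (simp add: add.commute)
    qed
    moreover have "(u, s) \<in> ?A \<times> ?S" using s by (simp add: u_def)
    ultimately show ?thesis by (rule image_eqI)
  qed
  then have sub: "range (\<lambda>t. factor limit (t * len j - half j) (width j)) \<subseteq> ?g ` (?A \<times> ?S)"
    by (rule image_subsetI)
  have fin: "finite (?A \<times> ?S)" using finite_factors[OF a] by simp
  have "card (range (\<lambda>t. factor limit (t * len j - half j) (width j))) \<le> card (?g ` (?A \<times> ?S))"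
    by (rule card_mono[OF finite_imageI[OF fin] sub])
  also have "\<dots> \<le> card (?A \<times> ?S)" by (rule card_image_le[OF fin])
  also have "\<dots> = card ?A * card ?S" by (rule card_cartesian_product)
  also have "\<dots> \<le> card ?A * (2 * width j)"
    using gap_le_len[of j] gap_pos[of j] int_width[of j] half_nonneg[of j] by (intro mult_left_mono) auto
  finally show ?thesis .
qed

lemma entropy_limit_le: "entropy (orbit_closure k limit) \<le> entropy (orbit_closure k a)"
proof -
  let ?B = "\<lambda>n. real (card (range (\<lambda>m. factor a m n)))"
  have sm: "filterlim width at_top sequentially"
    using strict_mono_width by (rule filterlim_subseq)
  have "(\<lambda>j. ln (?B (width j)) / real (width j)) \<longlonglongrightarrow> entropy (orbit_closure k a)"
    using filterlim_compose[OF entropy_limit[OF a] sm] .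
  moreover have "(\<lambda>j. ln (real (width j)) / real (width j)) \<longlonglongrightarrow> 0"
    using filterlim_compose[OF lim_ln_over_n sm] .
  moreover have "(\<lambda>j. 1 / real (width j)) \<longlonglongrightarrow> 0"
    using filterlim_compose[OF lim_1_over_n sm] .
  ultimately have "(\<lambda>j. ln (?B (width j)) / real (width j)
      + (ln 2 * (1 / real (width j)) + ln (real (width j)) / real (width j)))
      \<longlonglongrightarrow> entropy (orbit_closure k a) + (ln 2 * 0 + 0)"
    by (intro tendsto_add tendsto_mult tendsto_const)
  moreover have "entropy (orbit_closure k limit) \<le> ln (?B (width j)) / real (width j)
      + (ln 2 * (1 / real (width j)) + ln (real (width j)) / real (width j))" for j
  proof -
    let ?V = "card (range (\<lambda>t. factor limit (t * len j - half j) (width j)))"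
    have V: "?V > 0"
      using finite_subset[OF _ finite_factors[OF limit_topspace, of "width j"],
          of "range (\<lambda>t. factor limit (t * len j - half j) (width j))"]
      by (auto simp: card_gt_0_iff)
    have Bpos: "?B (width j) > 0" using card_factors_pos[OF a] by simp
    have "entropy (orbit_closure k limit) \<le> ln (real ?V) / real (width j)"
      using entropy_le_aligned[OF limit_topspace width_pos[of j], of "- half j"]
      unfolding int_width by simp
    also have "real ?V \<le> ?B (width j) * (2 * real (width j))"
      using of_nat_mono[OF card_cells[of j], where 'a = real] by simp
    then have "ln (real ?V) \<le> ln (?B (width j) * (2 * real (width j)))"
      using V Bpos width_pos[of j] by (subst ln_le_cancel_iff) auto
    then have "ln (real ?V) / real (width j) \<le> ln (?B (width j) * (2 * real (width j))) / real (width j)"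
      by (rule divide_right_mono) simp
    also have "ln (?B (width j) * (2 * real (width j))) = ln (?B (width j)) + (ln 2 + ln (real (width j)))"
      using Bpos width_pos[of j] by (simp add: ln_mult_pos)
    also have "\<dots> / real (width j) = ln (?B (width j)) / real (width j)
      + (ln 2 * (1 / real (width j)) + ln (real (width j)) / real (width j))"
      by (simp add: add_divide_distrib)
    finally show ?thesis .
  qed
  ultimately have "entropy (orbit_closure k limit) \<le> entropy (orbit_closure k a) + (ln 2 * 0 + 0)"
    by (rule tendsto_lowerbound[OF _ always_eventually[OF allI]]) simp
  then show ?thesis by simp
qed

subsection \<open>Frequency of errors\<close>

text \<open>
  This form of the bound \<open>lo j / len j \<le> k / K\<close> is the one that is preserved: the subtracted
  \<open>1\<close>, multiplied by \<open>2 * radius j * k\<close>, makes room for the term added to \<open>lo\<close>, which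
  contributes \<open>K * k * len j = k * radius j\<close>.
\<close>
lemma lo_bound: "K * lo j \<le> int k * (len j - 1)"
proof (induction j)
  case (Suc j)
  have "K * lo (Suc j) = 2 * radius j * (K * lo j) + int k * radius j"
    by (simp add: radius_def algebra_simps)
  also have "\<dots> \<le> 2 * radius j * (int k * (len j - 1)) + int k * radius j"
    using Suc radius_pos[of j] by (intro add_right_mono mult_left_mono) auto
  also have "\<dots> = int k * (2 * radius j * len j - radius j)" by (simp add: algebra_simps)
  also have "\<dots> \<le> int k * (len (Suc j) - 1)"
    unfolding len_Suc using radius_pos[of j] half_nonneg[of j]
    by (intro mult_left_mono) (simp_all add: algebra_simps)
  finally show ?case .
qed simp

lemma lo_le_len: "lo j \<le> len j"
proof -
  have "K * lo j \<le> int k * (len j - 1)" by (rule lo_bound)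
  also have "\<dots> \<le> K * len j" using K half_nonneg[of j] by (intro mult_mono) auto
  finally show ?thesis using K_ge by simp
qed

definition density :: real where
  "density = lim (\<lambda>j. lo j / len j)"

text \<open>
  The quotients \<open>lo j / len j\<close> increase: the middle subcell contributes \<open>k * len j\<close> to the next
  lower bound and every other subcell \<open>lo j\<close>, which is no more than that.
\<close>
lemma lo_density: "(\<lambda>j. lo j / len j) \<longlonglongrightarrow> density"
  and lo_le_density: "lo j \<le> density * len j"
  and density_le: "density \<le> k / K"
proof -
  have pos: "real_of_int (len j) > 0" for j using half_nonneg[of j] by linarith
  have mono: "lo j / len j \<le> lo (Suc j) / len (Suc j)" for j
  proof -
    have "1 * lo j \<le> int k * len j" using lo_le_len[of j] lo_nonneg[of j] k2 by (intro mult_mono) auto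
    then have "lo j * (2 * radius j + 1) \<le> lo (Suc j)" by (simp add: algebra_simps)
    then have "lo j * (2 * radius j + 1) * len j \<le> lo (Suc j) * len j"
      using half_nonneg[of j] by (intro mult_right_mono) auto
    then have "lo j * len (Suc j) \<le> lo (Suc j) * len j"
      unfolding len_Suc by (simp only: mult.assoc)
    then have "real_of_int (lo j) * len (Suc j) \<le> real_of_int (lo (Suc j)) * len j"
      by (simp only: of_int_mult[symmetric] of_int_le_iff)
    then show ?thesis
      by (simp only: pos_divide_le_eq[OF pos] pos_le_divide_eq[OF pos] times_divide_eq_left)
  qed
  then have inc: "incseq (\<lambda>j. lo j / len j)" by (rule incseq_SucI)
  have bound: "lo j / len j \<le> k / K" for j
  proof -
    have "K * lo j \<le> int k * len j" using lo_bound[of j] by (simp add: algebra_simps)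
    then have "real_of_int (K * lo j) \<le> real_of_int (int k * len j)"
      by (simp only: of_int_le_iff)
    then have "lo j * real_of_int K \<le> real k * len j" by (simp add: mult.commute)
    moreover have "real_of_int K > 0" using K_ge by linarith
    ultimately show ?thesis
      by (simp only: pos_divide_le_eq[OF pos] pos_le_divide_eq times_divide_eq_left)
  qed
  obtain L where "(\<lambda>j. lo j / len j) \<longlonglongrightarrow> L"
    by (rule incseq_convergent[OF inc allI[OF bound]])
  then show lim: "(\<lambda>j. lo j / len j) \<longlonglongrightarrow> density"
    unfolding density_def by (simp only: limI)
  show "lo j \<le> density * len j"
    using incseq_le[OF inc lim, of j] by (simp only: pos_divide_le_eq[OF pos])
  show "density \<le> k / K"
    by (rule LIMSEQ_le_const2[OF lim]) (intro exI allI impI bound)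
qed

lemma density_bounds: "0 \<le> density" "density \<le> 1"
proof -
  show "0 \<le> density" using lo_le_density[of 0] by simp
  have "real k \<le> K" using K by linarith
  then have "k / K \<le> 1" using K_ge by (simp add: divide_le_eq_1)
  then show "density \<le> 1" using density_le by linarith
qed

definition deviation :: "int \<Rightarrow> real" where
  "deviation n = \<bar>real (a n) - real (limit n)\<bar> - density"

lemma abs_deviation: "\<bar>deviation n\<bar> \<le> k"
proof -
  have "a n \<in> {1..k}" "limit n \<in> {1..k}"
    using a limit_topspace unfolding topspace_full_shift mem_Collect_eq by auto
  then have "1 \<le> real (a n)" "real (a n) \<le> k" "1 \<le> real (limit n)" "real (limit n) \<le> k" by auto
  then show ?thesis using density_bounds k2 unfolding deviation_def by linarith
qed

lemma sum_deviation_le: "\<bar>\<Sum>n\<in>A. deviation (f n)\<bar> \<le> real k * real (card A)"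
proof -
  have "\<bar>\<Sum>n\<in>A. deviation (f n)\<bar> \<le> (\<Sum>n\<in>A. \<bar>deviation (f n)\<bar>)" by (rule sum_abs)
  also have "\<dots> \<le> of_nat (card A) * real k" by (rule sum_bounded_above) (rule abs_deviation)
  finally show ?thesis by (simp only: mult.commute)
qed

text \<open>
  Bounds the distance between the error per symbol of a cell, which is at least \<open>lo j / len j\<close> and
  at most \<open>(lo j + gap j) / len j\<close>, and the density.
\<close>
definition tolerance :: "nat \<Rightarrow> real" where
  "tolerance j = (density - lo j / len j) + gap j / len j"

lemma tolerance_nonneg: "tolerance j \<ge> 0"
proof -
  have "real_of_int (len j) > 0" using half_nonneg[of j] by linarith
  then show ?thesis using lo_le_density[of j] gap_pos[of j]
    unfolding tolerance_def by (simp add: divide_le_eq)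
qed

lemma tolerance_tendsto: "tolerance \<longlonglongrightarrow> 0"
proof -
  have "(\<lambda>j. gap j / len j) \<longlonglongrightarrow> 0"
  proof (rule tendsto_sandwich[OF _ _ tendsto_const])
    show "\<forall>\<^sub>F j in sequentially. 0 \<le> gap j / len j"
    proof (intro always_eventually allI divide_nonneg_nonneg)
      show "0 \<le> real_of_int (gap j)" "0 \<le> real_of_int (len j)" for j
        using gap_pos[of j] half_nonneg[of j] by linarith+
    qed
    show "\<forall>\<^sub>F j in sequentially. gap j / len j \<le> (1 / 2) ^ j"
    proof (intro always_eventually allI)
      fix j
      have "real_of_int (gap j * 2 ^ j) \<le> real_of_int (len j)"
        using gap_halves[of j] by (simp only: of_int_le_iff)
      then have "real_of_int (gap j) * 2 ^ j \<le> len j" by simp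
      moreover have "real_of_int (len j) > 0" using half_nonneg[of j] by linarith
      ultimately show "gap j / len j \<le> (1 / 2) ^ j"
        by (simp add: power_divide divide_le_eq pos_le_divide_eq mult.commute)
    qed
    show "(\<lambda>j. (1 / 2) ^ j :: real) \<longlonglongrightarrow> 0" by (rule LIMSEQ_realpow_zero) auto
  qed
  then have "(\<lambda>j. (density - lo j / len j) + gap j / len j) \<longlonglongrightarrow> (density - density) + 0"
    by (intro tendsto_add tendsto_diff tendsto_const lo_density)
  then show ?thesis by (simp add: tolerance_def[abs_def])
qed

lemma deviation_good_cell:
  assumes "modelled j t t"
  shows "\<bar>\<Sum>i=-half j..half j. deviation (t * len j + i)\<bar> \<le> tolerance j * len j"
proof -
  let ?w = "shift_pow (t * len j) a"
  obtain s where s: "lo j \<le> s" "s \<le> lo j + gap j"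
    and eq: "\<And>i. -half j \<le> i \<Longrightarrow> i \<le> half j \<Longrightarrow> limit (t * len j + i) = fill j ?w s i"
    using assms unfolding modelled_def by blast
  have pos: "real_of_int (len j) > 0" using half_nonneg[of j] by linarith
  have "(\<Sum>i=-half j..half j. \<bar>real (a (t * len j + i)) - real (limit (t * len j + i))\<bar>)
      = real_of_int (err ?w (fill j ?w s) (half j))"
    unfolding err_def of_int_sum
  proof (rule sum.cong[OF refl])
    fix i assume i: "i \<in> {-half j..half j}"
    have "?w i = a (t * len j + i)" by (simp add: shift_pow_def add.commute)
    then show "\<bar>real (a (t * len j + i)) - real (limit (t * len j + i))\<bar>
        = real_of_int \<bar>int (?w i) - int (fill j ?w s i)\<bar>"
      using eq[of i] i by simp
  qed
  also have "\<dots> = s" by (simp add: err_fill[OF shift_pow_topspace[OF a] s])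
  finally have "(\<Sum>i=-half j..half j. deviation (t * len j + i)) = s - density * len j"
    using half_nonneg[of j] by (simp add: deviation_def sum_subtractf algebra_simps)
  moreover have "tolerance j * len j = density * len j - lo j + gap j"
  proof -
    have "(d - x / L + g / L) * L = d * L - x + g" if "L > 0" for d x g L :: real
      using that by (simp add: field_simps)
    from this[OF pos] show ?thesis unfolding tolerance_def .
  qed
  ultimately show ?thesis using s lo_le_density[of j] gap_pos[of j] by linarith
qed

text \<open>
  Prescribed errors measure the distance to \<open>a\<close> only on cells modelled on \<open>a\<close> at the same place.
  Within the cell of level \<open>j + 2\<close> around \<open>0\<close>, the subcells of level \<open>j + 1\<close> all have this
  property, and hence so do the subcells of level \<open>j\<close> except middle ones, whose indices are the multiples
  of \<open>2 * radius j + 1\<close>.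
\<close>
lemma modelled_self:
  assumes c: "\<bar>t\<bar> \<le> radius (Suc j) * (2 * radius j + 1) + radius j"
    and t: "\<not> (2 * radius j + 1) dvd t"
  shows "modelled j t t"
proof -
  let ?r = "radius j" and ?R = "radius (Suc j)"
  define T where "T = (t + ?r) div (2 * ?r + 1)"
  have r: "0 \<le> ?r" using radius_pos[of j] by simp
  obtain u where tu: "t = T * (2 * ?r + 1) + u" and u: "-?r \<le> u" "u \<le> ?r"
    using cell_offset[OF r, of t] unfolding T_def by blast
  have "u \<noteq> 0" using t tu by auto
  have T: "-?R \<le> T" "T \<le> ?R"
    using cell_index_bounds[OF r, of ?R t] c unfolding T_def by auto
  have "modelled (Suc j) T T"
  proof (cases "T = 0")
    case False
    then show ?thesis using modelled_sub[OF modelled_0 False T] by simp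
  qed (simp add: modelled_0)
  from modelled_sub[OF this \<open>u \<noteq> 0\<close> u] show ?thesis by (simp only: tu[symmetric])
qed

lemma card_multiples_le:
  fixes c q :: int
  assumes "q > 0" "c \<ge> 0"
  shows "int (card {t\<in>{-c..c}. q dvd t}) \<le> 2 * (c div q) + 1"
proof -
  have "{t\<in>{-c..c}. q dvd t} \<subseteq> (\<lambda>v. q * v) ` {-(c div q)..c div q}"
  proof
    fix t assume t: "t \<in> {t\<in>{-c..c}. q dvd t}"
    then obtain v where v: "t = q * v" by auto
    then have "v * q \<le> c" "(-v) * q \<le> c" using t by (auto simp: mult.commute)
    then have "v \<le> c div q" "-v \<le> c div q"
      using zdiv_mono1[of "v * q" c q] zdiv_mono1[of "(-v) * q" c q] assms(1)
        nonzero_mult_div_cancel_right[of q v] nonzero_mult_div_cancel_right[of q "-v"]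
      by (simp_all del: mult_minus_left)
    then show "t \<in> (\<lambda>v. q * v) ` {-(c div q)..c div q}" using v by auto
  qed
  then have "card {t\<in>{-c..c}. q dvd t} \<le> card {-(c div q)..c div q}"
    by (rule surj_card_le[rotated]) simp
  moreover have "c div q \<ge> 0" using assms by (simp add: pos_imp_zdiv_nonneg_iff)
  ultimately show ?thesis by simp
qed

text \<open>
  A window reaching from level \<open>j + 1\<close> to level \<open>j + 2\<close> is measured in cells of level \<open>j\<close>: the
  level \<open>j + 1\<close> would be too coarse, as the two cells cut by the boundary of the window could
  make up a fixed proportion of it. On the scale of level \<open>j\<close> the cut cells and the middle
  subcells each occupy at most a proportion \<open>2 / (2 * radius j + 1)\<close>, and all other cells
  deviate by the tolerance.
\<close>
lemma sum_deviation:
  assumes N: "half (Suc j) \<le> N" "N \<le> half (Suc (Suc j))"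
  shows "\<bar>\<Sum>n=-N..N. deviation n\<bar> \<le> (tolerance j + 4 * real k / (2 * radius j + 1)) * (2 * N + 1)"
proof -
  let ?h = "half j" and ?l = "len j" and ?q = "2 * radius j + 1"
  define c where "c = (N - ?h) div ?l"
  \<comment> \<open>the largest union of cells of level \<open>j\<close> centred at \<open>0\<close> inside the window ends at \<open>M\<close>\<close>
  define M where "M = c * ?l + ?h"
  have l: "?l > 0" using half_nonneg[of j] by linarith
  have q: "?q > 0" using radius_pos[of j] by linarith
  have NM: "M \<le> N" "N < M + ?l"
    using div_mult_mod_eq[of "N - ?h" ?l] pos_mod_bound[OF l, of "N - ?h"] pos_mod_sign[OF l, of "N - ?h"]
    unfolding M_def c_def by linarith+
  have c0: "0 \<le> c"
    unfolding c_def using N(1) half_Suc_less[of j] l by (simp add: pos_imp_zdiv_nonneg_iff)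
  have M0: "0 \<le> M" unfolding M_def using c0 l by simp
  have cl: "(2 * c + 1) * ?l \<le> 2 * N + 1" using NM(1) by (simp add: M_def algebra_simps)
  have ql: "?q * ?l \<le> 2 * N + 1" using N(1) len_Suc[of j] by linarith
  have c_le: "c \<le> radius (Suc j) * ?q + radius j"
  proof -
    have "c * ?l \<le> (radius (Suc j) * ?q + radius j) * ?l"
      using NM(1) N(2) unfolding half_Suc[of "Suc j"] len_Suc half_Suc[of j] M_def
      by (simp add: algebra_simps)
    then show ?thesis using l by (simp add: mult_le_cancel_right)
  qed
  let ?D = "{t\<in>{-c..c}. ?q dvd t}"
  have "\<bar>\<Sum>n=-M..M. deviation n\<bar> = \<bar>\<Sum>t=-c..c. \<Sum>i=-?h..?h. deviation (t * ?l + i)\<bar>"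
    unfolding M_def by (subst sum_cells) auto
  also have "\<dots> \<le> (\<Sum>t=-c..c. tolerance j * ?l + (if ?q dvd t then real k * ?l else 0))"
  proof (rule order_trans[OF sum_abs sum_mono])
    fix t assume t: "t \<in> {-c..c}"
    show "\<bar>\<Sum>i=-?h..?h. deviation (t * ?l + i)\<bar> \<le> tolerance j * ?l + (if ?q dvd t then real k * ?l else 0)"
    proof (cases "?q dvd t")
      case True
      have "\<bar>\<Sum>i=-?h..?h. deviation (t * ?l + i)\<bar> \<le> real k * real (card {-?h..?h})"
        by (rule sum_deviation_le)
      also have "\<dots> = k * ?l" using half_nonneg[of j] by simp
      finally show ?thesis using True tolerance_nonneg[of j] l by (simp add: add_increasing)
    next
      case False
      moreover have "\<bar>t\<bar> \<le> radius (Suc j) * ?q + radius j" using t c_le by auto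
      ultimately show ?thesis using deviation_good_cell[OF modelled_self] by simp
    qed
  qed
  also have "\<dots> = tolerance j * ((2 * c + 1) * ?l) + real k * (real (card ?D) * ?l)"
    using c0 by (simp add: sum.distrib sum.inter_filter[symmetric] algebra_simps)
  also have "\<dots> \<le> tolerance j * (2 * N + 1) + k * (2 * ((2 * N + 1) / ?q))"
  proof (intro add_mono mult_left_mono tolerance_nonneg)
    show "real_of_int ((2 * c + 1) * ?l) \<le> real_of_int (2 * N + 1)" using cl by (simp only: of_int_le_iff)
    have "int (card ?D) * ?q \<le> (2 * (c div ?q) + 1) * ?q"
      using card_multiples_le[OF q c0] q by (intro mult_right_mono) auto
    also have "\<dots> = 2 * (c div ?q * ?q) + ?q" by (simp only: distrib_right mult.assoc mult_1)
    also have "\<dots> \<le> 2 * c + ?q" using div_mult_mod_eq[of c ?q] pos_mod_sign[OF q, of c] by linarith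
    finally have "int (card ?D) * ?q * ?l \<le> (2 * c + ?q) * ?l" using l by (intro mult_right_mono) auto
    also have "\<dots> = (2 * c + 1) * ?l - ?l + ?q * ?l" by (simp only: distrib_right mult_1)
    also have "\<dots> \<le> 2 * (2 * N + 1)"
    proof -
      have "P - L + Q \<le> 2 * X" if "P \<le> X" "Q \<le> X" "0 < L" for P Q L X :: int
        using that by linarith
      from this[OF cl ql l] show ?thesis .
    qed
    finally have "int (card ?D) * ?l * ?q \<le> 2 * (2 * N + 1)" by (simp only: ac_simps)
    then have "real_of_int (int (card ?D) * ?l * ?q) \<le> real_of_int (2 * (2 * N + 1))"
      by (simp only: of_int_le_iff)
    then show "real (card ?D) * ?l \<le> 2 * ((2 * N + 1) / ?q)"
      using q by (simp add: pos_le_divide_eq)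
  qed simp
  finally have inner: "\<bar>\<Sum>n=-M..M. deviation n\<bar> \<le> tolerance j * (2 * N + 1) + k * (2 * ((2 * N + 1) / ?q))" .
  have "(\<Sum>n=-N..N. deviation n) = (\<Sum>n\<in>{-N..N} - {-M..M}. deviation n) + (\<Sum>n=-M..M. deviation n)"
    using NM(1) by (intro sum.subset_diff) auto
  moreover have "\<bar>\<Sum>n\<in>{-N..N} - {-M..M}. deviation n\<bar> \<le> k * (2 * ((2 * N + 1) / ?q))"
  proof -
    have "\<bar>\<Sum>n\<in>{-N..N} - {-M..M}. deviation n\<bar> \<le> real k * real (card ({-N..N} - {-M..M}))"
      by (rule sum_deviation_le)
    also have "\<dots> \<le> real k * (2 * ((2 * N + 1) / ?q))"
    proof (rule mult_left_mono)
      have "int (card ({-N..N} - {-M..M})) = 2 * (N - M)"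
        using NM(1) M0 by (subst card_Diff_subset) auto
      also have "\<dots> \<le> 2 * ?l" using NM(2) by (intro mult_left_mono) auto
      finally have "int (card ({-N..N} - {-M..M})) \<le> 2 * ?l" .
      then have "int (card ({-N..N} - {-M..M})) * ?q \<le> 2 * ?l * ?q" using q by (intro mult_right_mono) auto
      also have "\<dots> = 2 * (?q * ?l)" by (simp only: ac_simps)
      also have "\<dots> \<le> 2 * (2 * N + 1)" using ql by (rule mult_left_mono) simp
      finally have "real_of_int (int (card ({-N..N} - {-M..M})) * ?q) \<le> real_of_int (2 * (2 * N + 1))"
        by (simp only: of_int_le_iff)
      then show "real (card ({-N..N} - {-M..M})) \<le> 2 * ((2 * N + 1) / ?q)"
        using q by (simp add: pos_le_divide_eq)
    qed simp
    finally show ?thesis .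
  qed
  ultimately have "\<bar>\<Sum>n=-N..N. deviation n\<bar>
      \<le> tolerance j * (2 * N + 1) + k * (2 * ((2 * N + 1) / ?q)) + k * (2 * ((2 * N + 1) / ?q))"
    using inner by linarith
  also have "\<dots> = (tolerance j + 4 * real k / ?q) * (2 * N + 1)"
  proof -
    have "x * X + y * (2 * (X / z)) + y * (2 * (X / z)) = (x + 4 * y / z) * X" for x y z X :: real
      by (simp add: algebra_simps)
    then show ?thesis .
  qed
  finally show ?thesis .
qed

lemma mean_error_tendsto:
  "(\<lambda>N::nat. (\<Sum>n=- int N..int N. \<bar>real (a n) - real (limit n)\<bar>) / (2 * real N + 1)) \<longlonglongrightarrow> density"
proof (rule LIMSEQ_I)
  fix e :: real assume e: "e > 0"
  have "(\<lambda>j. 4 * real k / (2 * radius j + 1)) \<longlonglongrightarrow> 0"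
  proof (rule tendsto_sandwich[OF _ _ tendsto_const])
    show "\<forall>\<^sub>F j in sequentially. 4 * real k / (2 * radius j + 1) \<le> 4 * real k * (1 / real j)"
    proof (rule eventually_sequentiallyI[of 1])
      fix j :: nat assume "j \<ge> 1"
      moreover have "real j \<le> real_of_int (2 * radius j + 1)"
        using half_ge[of j] len_le_radius[of j] radius_pos[of j] by linarith
      ultimately have "4 * real k / (2 * radius j + 1) \<le> 4 * real k / real j"
        by (intro frac_le) auto
      then show "4 * real k / (2 * radius j + 1) \<le> 4 * real k * (1 / real j)" by simp
    qed
    show "\<forall>\<^sub>F j in sequentially. 0 \<le> 4 * real k / (2 * radius j + 1)"
    proof (intro always_eventually allI divide_nonneg_nonneg)
      show "0 \<le> real_of_int (2 * radius j + 1)" for j using radius_pos[of j] by linarith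
    qed simp
    have "(\<lambda>j. 4 * real k * (1 / real j)) \<longlonglongrightarrow> 4 * real k * 0"
      by (rule tendsto_mult[OF tendsto_const lim_1_over_n])
    then show "(\<lambda>j. 4 * real k * (1 / real j)) \<longlonglongrightarrow> 0" by simp
  qed
  then have "(\<lambda>j. tolerance j + 4 * real k / (2 * radius j + 1)) \<longlonglongrightarrow> 0 + 0"
    by (intro tendsto_add tolerance_tendsto)
  then have "\<forall>\<^sub>F j in sequentially. tolerance j + 4 * real k / (2 * radius j + 1) < e"
    by (rule order_tendstoD(2)) (simp add: e)
  then obtain J where J: "\<And>j. j \<ge> J \<Longrightarrow> tolerance j + 4 * real k / (2 * radius j + 1) < e"
    unfolding eventually_sequentially by blast
  have "norm ((\<Sum>n=- int N..int N. \<bar>real (a n) - real (limit n)\<bar>) / (2 * real N + 1) - density) < e"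
    if N: "N \<ge> nat (half (Suc J))" for N
  proof -
    (* p is the least level whose central cell covers the window. The level sought is p - 2, unless
       the window is the central cell of level J + 1 itself. *)
    have scale: "\<exists>j\<ge>J. half (Suc j) \<le> int N \<and> int N \<le> half (Suc (Suc j))"
    proof -
      define p where "p = (LEAST i. int N \<le> half i)"
      have ex: "int N \<le> half N" by (rule half_ge)
      have p: "int N \<le> half p" unfolding p_def by (rule LeastI[of _ N]) (rule ex)
      have below: "half i < int N" if "i < p" for i
        using not_less_Least[of i "\<lambda>i. int N \<le> half i"] that unfolding p_def by simp
      have NJ: "half (Suc J) \<le> int N" using N by simp
      show ?thesis
      proof (cases "p \<le> Suc J")
        case True
        then have "int N = half (Suc J)" using p half_mono[OF True] NJ by linarith
        then show ?thesis using half_Suc_less[of "Suc J"] by (intro exI[of _ J]) auto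
      next
        case False
        define j where "j = p - 2"
        have "p = Suc (Suc j)" "j \<ge> J" using False by (auto simp: j_def)
        then show ?thesis using p below[of "Suc j"] by (intro exI[of _ j]) auto
      qed
    qed
    then obtain j where j: "j \<ge> J" "half (Suc j) \<le> int N" "int N \<le> half (Suc (Suc j))" by blast
    have pos: "2 * real N + 1 > 0" by simp
    have "(\<Sum>n=- int N..int N. deviation n)
        = (\<Sum>n=- int N..int N. \<bar>real (a n) - real (limit n)\<bar>) - density * (2 * real N + 1)"
      by (simp add: deviation_def sum_subtractf algebra_simps)
    moreover have "\<bar>\<Sum>n=- int N..int N. deviation n\<bar>
        \<le> (tolerance j + 4 * real k / (2 * radius j + 1)) * (2 * real N + 1)"
      using sum_deviation[OF j(2,3)] by simp
    moreover have "(tolerance j + 4 * real k / (2 * radius j + 1)) * (2 * real N + 1) < e * (2 * real N + 1)"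
      using J[OF j(1)] pos by (rule mult_strict_right_mono)
    ultimately have "\<bar>(\<Sum>n=- int N..int N. \<bar>real (a n) - real (limit n)\<bar>) - density * (2 * real N + 1)\<bar>
        < e * (2 * real N + 1)" by linarith
    moreover have "S / (2 * real N + 1) - density = (S - density * (2 * real N + 1)) / (2 * real N + 1)"
      for S using pos by (simp add: field_simps)
    ultimately show ?thesis using pos by (simp add: abs_divide pos_divide_less_eq)
  qed
  then show "\<exists>N0. \<forall>N\<ge>N0. norm ((\<Sum>n=- int N..int N. \<bar>real (a n) - real (limit n)\<bar>) / (2 * real N + 1) - density) < e"
    by blast
qed

end

theorem theorem1p1:
  fixes k :: nat and a :: "int \<Rightarrow> nat" and \<epsilon> :: real
  assumes "k \<ge> 2"
    and "a \<in> topspace (full_shift k)"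
    and "\<epsilon> > 0"
  shows "\<exists>b. toeplitz k b \<and>
           entropy (orbit_closure k b) \<le> 2 * entropy (orbit_closure k a) \<and>
           (\<exists>L. (\<lambda>N::nat. (\<Sum>n = - int N..int N. \<bar>real (a n) - real (b n)\<bar>) / (2 * real N + 1))
                  \<longlonglongrightarrow> L \<and> L < \<epsilon>)"
proof -
  \<comment> \<open>\<open>K \<ge> k\<close> makes the budgets feasible, \<open>K > k / \<epsilon>\<close> makes the density smaller than \<open>\<epsilon>\<close>\<close>
  define K where "K = max (int k) (\<lfloor>k / \<epsilon>\<rfloor> + 1)"
  interpret toeplitz_approximation k K a
    using assms(1,2) by unfold_locales (simp_all add: K_def)
  have "k / \<epsilon> < K" unfolding K_def by linarith
  then have "k < K * \<epsilon>" using assms(3) by (simp add: pos_divide_less_eq)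
  then have "k / K < \<epsilon>" using K_ge by (simp add: pos_divide_less_eq mult.commute)
  then have "density < \<epsilon>" using density_le by linarith
  moreover have "entropy (orbit_closure k limit) \<le> 2 * entropy (orbit_closure k a)"
    using entropy_limit_le entropy_nonneg[OF assms(2)] by linarith
  ultimately show ?thesis using toeplitz_limit mean_error_tendsto by blast
qed

end
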